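(* If the utility of the optimal arm is higher than the utility of the other arms by $\delta$ for every time step, then the number of mistakes of the Prediction Algorithm (defined in the context) in the first $T$ rounds, i.e. the number of time steps $t\le T$ with $p_t\neq a_t$, is bounded by $$\frac{k^4(f(T)+1)\log(T)+f(T)}{\delta}.$$
   Context: Setting. An agent plays a multi-armed bandit game with $k$ arms, $[k]=\{1,\ldots,k\}$. In each time step $t=1,2,\ldots$ each arm $i$ has a cost $c^t_i$, which may change over time and is observed by the agent and by the prediction algorithm at the beginning of step $t$. The reward (value) of playing arm $i$ in any time step is drawn from a fixed distribution with expected value $v_i$, $0\le v_i\le 1$; the agent does not know $v_i$ but privately observes the reward after playing an arm; the prediction algorithm observes no rewards. The utility of an arm $i$ at time $t$ is its value minus the cost of playing it, $v_i-c^t_i$. The optimal arm at time $t$ is $o_t=\arg\max_{i\in[k]}\{v_i-c^t_i\}$. The arm played by the agent at time $t$ is $a_t$, and her regret at that step is $ar_t=(v_{o_t}-c^t_{o_t})-(v_{a_t}-c^t_{a_t})$. The agent uses an arbitrary strategy whose total regret satisfies $\sum_{t=1}^{T}ar_t\le f(T)$ for each time step $T$, where $f$ is a given function. A prediction algorithm picks at each step $t$ an arm $p_t$, given the costs $c^1,\ldots,c^t$ and the agent's past actions $a_1,\ldots,a_{t-1}$. A mistake (wrong prediction) is a time step $t$ with $p_t\ne a_t$. Consistent values. $CV(t)$ is the set of all vectors $u\in[0,1]^k$ for which there exists a real vector $r$ such that $u_{a_\ell}-c^\ell_{a_\ell}\ge u_i-c^\ell_i-r_\ell$ for all $\ell\in[t-1]$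 and all $i\in[k]$, and $\sum_{j\le \ell} r_j\le f(\ell)$ for all $\ell\in[t-1]$. Prediction Algorithm. At each time step $t$, for each arm $i$ let $w_i$ be the probability, for $u$ chosen uniformly at random from $CV(t)$, that $u_i-c^t_i\ge u_j-c^t_j$ for all $j\in[k]$; the algorithm picks $p_t=\arg\max_i w_i$.
   Formalization: The regret bound f is assumed nondecreasing and T is assumed at least 2; without these the stated bound fails (e.g. at T = 1 with f = 0 since log 1 = 0, or when f is huge before T and f(T) = 0). *)

theory Defs
  imports "HOL-Probability.Probability"
begin

text \<open>
  Arms are the elements of a finite type \<open>'k\<close>, so \<open>k = CARD('k)\<close>. Value vectors and
  the cost vectors \<open>c t\<close> live in \<open>real ^ 'k\<close>. Time steps are the natural numbers
  \<open>t \<ge> 1\<close>; the entries of a sequence at index \<open>0\<close> are never used.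
\<close>

definition utility :: "real ^ 'k \<Rightarrow> (nat \<Rightarrow> real ^ 'k) \<Rightarrow> nat \<Rightarrow> 'k::finite \<Rightarrow> real" where
  "utility v c t i = v $ i - c t $ i"

definition optimal_arm :: "real ^ 'k \<Rightarrow> (nat \<Rightarrow> real ^ 'k) \<Rightarrow> nat \<Rightarrow> 'k::finite" where
  "optimal_arm v c t = arg_max (utility v c t) (\<lambda>_. True)"

definition agent_regret ::
  "real ^ 'k \<Rightarrow> (nat \<Rightarrow> real ^ 'k) \<Rightarrow> (nat \<Rightarrow> 'k::finite) \<Rightarrow> nat \<Rightarrow> real" where
  "agent_regret v c a t = utility v c t (optimal_arm v c t) - utility v c t (a t)"

definition consistent_values ::
  "(nat \<Rightarrow> real) \<Rightarrow> (nat \<Rightarrow> real ^ 'k) \<Rightarrow> (nat \<Rightarrow> 'k::finite) \<Rightarrow> nat \<Rightarrow> (real ^ 'k) set" where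
  "consistent_values f c a t =
     {u. (\<forall>i. 0 \<le> u $ i \<and> u $ i \<le> 1) \<and>
         (\<exists>r :: nat \<Rightarrow> real.
            (\<forall>l\<in>{1..<t}. \<forall>i. utility u c l (a l) \<ge> utility u c l i - r l) \<and>
            (\<forall>l\<in>{1..<t}. (\<Sum>j = 1..l. r j) \<le> f l))}"

text \<open>
  The uniform distribution on a nonempty compact convex set \<open>K\<close>. A set of consistent values can
  be nonempty and Lebesgue-null, so uniform refers to the volume on the affine hull of \<open>K\<close>:
  thicken \<open>K\<close> to full dimension by the unit ball of the orthogonal complement, take the
  normalised Lebesgue measure there, and project back orthogonally onto the affine hull. By the
  product structure of Lebesgue measure this is normalised \<open>d\<close>-dimensional volume,
  \<open>d = aff_dim K\<close>. If \<open>K\<close> has interior points, it is just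
  \<^term>\<open>uniform_measure lborel K\<close>, see \<open>uniform_on_eq_uniform_measure\<close>; if
  \<open>K = {x}\<close>, it is the point mass at \<open>x\<close>.
\<close>

definition uniform_on :: "'a::euclidean_space set \<Rightarrow> 'a measure" where
  "uniform_on K =
     (let P = closest_point (affine hull K)
      in distr (uniform_measure lborel {y. P y \<in> K \<and> dist y (P y) \<le> 1}) borel P)"

lemma uniform_on_eq_uniform_measure:
  fixes K :: "'a::euclidean_space set"
  assumes "interior K \<noteq> {}"
  shows "uniform_on K = uniform_measure lborel K"
proof -
  have P: "closest_point (affine hull K) = (\<lambda>y. y)"
    using assms by (auto simp: affine_hull_nonempty_interior closest_point_self)
  show ?thesis
    unfolding uniform_on_def Let_def P by (simp add: distr_id2)
qed

lemma prob_uniform_on_singleton: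
  fixes x :: "'a::euclidean_space"
  assumes "A \<in> sets borel"
  shows "measure (uniform_on {x}) A = indicator A x"
proof -
  have P: "closest_point (affine hull {x}) = (\<lambda>y. x)"
    using closest_point_in_set[of "{x}"] by auto
  have S: "{y. x \<in> {x} \<and> dist y x \<le> 1} = cball x 1"
    by (auto simp: dist_commute)
  have "emeasure lborel (cball x 1) \<noteq> 0" "emeasure lborel (cball x 1) \<noteq> \<infinity>"
    using content_cball_pos[of 1 x] emeasure_lborel_cball_finite[of x 1]
    by (auto simp: measure_def)
  then have "prob_space (uniform_measure lborel (cball x 1))"
    by (intro prob_space_uniform_measure) auto
  then interpret prob_space "uniform_measure lborel (cball x 1)" .
  show ?thesis
    unfolding uniform_on_def Let_def P S using assms prob_space
    by (subst measure_distr) (auto simp: indicator_def)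
qed

definition optimality_prob ::
  "(nat \<Rightarrow> real) \<Rightarrow> (nat \<Rightarrow> real ^ 'k) \<Rightarrow> (nat \<Rightarrow> 'k::finite) \<Rightarrow> nat \<Rightarrow> 'k \<Rightarrow> real" where
  "optimality_prob f c a t i =
     measure (uniform_on (consistent_values f c a t)) {u. \<forall>j. utility u c t i \<ge> utility u c t j}"

text \<open>Ties in the argmax may be broken arbitrarily.\<close>

definition prediction_algorithm ::
  "(nat \<Rightarrow> real) \<Rightarrow> (nat \<Rightarrow> real ^ 'k) \<Rightarrow> (nat \<Rightarrow> 'k::finite) \<Rightarrow> (nat \<Rightarrow> 'k) \<Rightarrow> bool" where
  "prediction_algorithm f c a p \<longleftrightarrow>
     (\<forall>t\<ge>1. is_arg_max (optimality_prob f c a t) (\<lambda>_. True) (p t))"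

end

theory Submission
  imports Defs
begin

text \<open>
  A step where the agent plays suboptimally costs her \<open>\<delta>\<close>, which accounts for \<open>f T / \<delta>\<close> mistakes.
  Suppose now the agent plays the optimal arm \<open>b\<close> and the prediction is wrong. Then \<open>b\<close> is strictly
  optimal on at most half of the convex set \<open>K\<close> of consistent values, so shrinking \<open>K\<close> towards the
  true values \<open>v\<close> by the factor \<open>l\<close> with \<open>l\<^sup>k = 1 / 2\<close> cannot bring all of it into that region. Hence
  there are \<open>j \<noteq> b\<close> and \<open>u \<in> K\<close> for which the threshold between \<open>b\<close> and \<open>j\<close> lies, measured
  from \<open>v\<close> along \<open>u\<^sub>j - u\<^sub>b\<close>, at a position \<open>\<gamma>\<close> with \<open>\<delta> \<le> \<gamma> \<le> l * D\<close>, where \<open>D\<close> is the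
  position of \<open>u\<close>. At every such step a consistent point at position \<open>y\<close> incurs regret at least \<open>y - \<gamma>\<close>, and
  its total regret is at most \<open>f T\<close>. For a fixed pair \<open>(j, b)\<close> this is a one-dimensional
  problem; it bounds the number of such steps by a multiple of \<open>k\<^sup>2 * (f T + 1) / \<delta>\<close>. Since only
  widths are compared, never volumes of \<open>K\<close> at different times, it is harmless that \<open>K\<close> may
  become arbitrarily thin or lower-dimensional.
\<close>

subsection \<open>Uniform distributions on convex bodies\<close>

text \<open>A homothety scales all distances by \<open>\<bar>l\<bar>\<close>, and its inverse keeps
  every competitor \<open>z\<close> inside the affine set because the centre lies there. A point
  closer to the image would thus pull back to one closer to \<open>y\<close>.\<close>

lemma closest_point_homothety:
  fixes S :: "'a::euclidean_space set"
  assumes "affine S" "closed S" "v \<in> S" "l \<noteq> 0"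
  shows "closest_point S (v + l *\<^sub>R (y - v)) = v + l *\<^sub>R (closest_point S y - v)"
proof (rule closest_point_unique[symmetric])
  have scale: "dist (l *\<^sub>R x) (l *\<^sub>R z) = \<bar>l\<bar> * dist x z" for x z :: 'a
    by (simp add: dist_norm flip: scaleR_right_diff_distrib)
  have S: "S \<noteq> {}" using assms by auto
  show "convex S" "closed S" using assms by (auto simp: affine_imp_convex)
  show "v + l *\<^sub>R (closest_point S y - v) \<in> S"
    using closest_point_in_set[OF \<open>closed S\<close> S, of y] assms by (intro mem_affine_3_minus) auto
  show "\<forall>z\<in>S. dist (v + l *\<^sub>R (y - v)) (v + l *\<^sub>R (closest_point S y - v))
          \<le> dist (v + l *\<^sub>R (y - v)) z"
  proof
    fix z assume "z \<in> S"
    then have "v + (1 / l) *\<^sub>R (z - v) \<in> S"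
      using assms by (intro mem_affine_3_minus) auto
    then have "dist y (closest_point S y) \<le> dist y (v + (1 / l) *\<^sub>R (z - v))"
      using assms by (intro closest_point_le)
    then have "\<bar>l\<bar> * dist y (closest_point S y) \<le> \<bar>l\<bar> * dist y (v + (1 / l) *\<^sub>R (z - v))"
      by (rule mult_left_mono) simp
    also have "\<dots> = dist (l *\<^sub>R y) (l *\<^sub>R (v + (1 / l) *\<^sub>R (z - v)))"
      by (rule scale[symmetric])
    also have "\<dots> = dist (v + l *\<^sub>R (y - v)) z"
      using \<open>l \<noteq> 0\<close> by (simp add: dist_norm algebra_simps)
    finally show "dist (v + l *\<^sub>R (y - v)) (v + l *\<^sub>R (closest_point S y - v))
        \<le> dist (v + l *\<^sub>R (y - v)) z"
      by (simp add: dist_norm flip: scaleR_right_diff_distrib)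
  qed
qed

context
  fixes K :: "'a::euclidean_space set"
  assumes K: "compact K" "convex K" "K \<noteq> {}"
begin

private abbreviation "P \<equiv> closest_point (affine hull K)"
private abbreviation "Y \<equiv> {y. P y \<in> K \<and> dist y (P y) \<le> 1}"

private lemma continuous_proj: "continuous_on UNIV P"
  using K by (intro continuous_on_closest_point) (auto simp: affine_imp_convex)

private lemma measurable_proj: "P \<in> borel_measurable borel"
  using continuous_proj by (rule borel_measurable_continuous_onI)

private lemma compact_thickening: "compact Y"
proof -
  have "closed (P -` K)"
    using K continuous_proj by (intro closed_vimage compact_imp_closed)
  moreover have "closed {y. dist y (P y) \<le> 1}"
    by (intro closed_Collect_le continuous_intros continuous_proj)
  ultimately have "closed (P -` K \<inter> {y. dist y (P y) \<le> 1})" by (rule closed_Int)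
  moreover have "P -` K \<inter> {y. dist y (P y) \<le> 1} = Y" by auto
  moreover have "bounded Y"
  proof -
    obtain B where B: "\<And>x. x \<in> K \<Longrightarrow> norm x \<le> B"
      using compact_imp_bounded[OF K(1)] unfolding bounded_iff by auto
    have "norm y \<le> B + 1" if "y \<in> Y" for y
      using B[of "P y"] that norm_triangle_sub[of y "P y"] by (auto simp: dist_norm)
    then show ?thesis by (auto simp: bounded_iff)
  qed
  ultimately show ?thesis by (simp add: compact_eq_bounded_closed)
qed

text \<open>Finiteness is compactness. For positivity, the projection is 1-Lipschitz and fixes a
  relative interior point \<open>z\<close>, so points near \<open>z\<close> project into
  \<open>K\<close> and a full-dimensional ball about \<open>z\<close> lies in the
  thickening.\<close>

private lemma emeasure_thickening:
  "emeasure lborel Y \<noteq> 0" "emeasure lborel Y \<noteq> \<infinity>"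
proof -
  show "emeasure lborel Y \<noteq> \<infinity>"
    using emeasure_compact_finite[OF compact_thickening] by simp
  obtain z where "z \<in> rel_interior K"
    using K rel_interior_eq_empty by blast
  then obtain e where z: "z \<in> K" and e: "e > 0" "cball z e \<inter> affine hull K \<subseteq> K"
    by (auto simp: mem_rel_interior_cball)
  have zA: "z \<in> affine hull K" using z by (rule hull_inc)
  have "ball z (min e 1) \<subseteq> Y"
  proof
    fix y assume y: "y \<in> ball z (min e 1)"
    have "dist (P z) (P y) \<le> dist z y"
      using K by (intro closest_point_lipschitz) (auto simp: affine_imp_convex)
    then have "dist z (P y) \<le> dist z y" using zA by (simp add: closest_point_self)
    moreover have "P y \<in> affine hull K" using K by (intro closest_point_in_set) auto
    ultimately have "P y \<in> K" using e y by auto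
    moreover have "dist y (P y) \<le> dist y z" using zA by (intro closest_point_le) auto
    ultimately show "y \<in> Y" using y by (auto simp: dist_commute)
  qed
  moreover have "Y \<in> sets lborel"
    using compact_thickening by (simp add: borel_compact)
  ultimately have "emeasure lborel (ball z (min e 1)) \<le> emeasure lborel Y"
    by (intro emeasure_mono)
  moreover have "emeasure lborel (ball z (min e 1)) \<noteq> 0"
    using content_ball_pos[of "min e 1" z] e by (auto simp: measure_def)
  ultimately show "emeasure lborel Y \<noteq> 0" by auto
qed

lemma prob_space_uniform_on: "prob_space (uniform_on K)"
proof -
  interpret prob_space "uniform_measure lborel Y"
    using emeasure_thickening by (intro prob_space_uniform_measure) auto
  show ?thesis
    unfolding uniform_on_def Let_def using measurable_proj by (intro prob_space_distr) simp
qed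

text \<open>The homothety maps the thickened body into itself and commutes with the projection.\<close>

lemma measure_uniform_on_homothety_ge:
  assumes v: "v \<in> K" and l: "0 < l" "l \<le> 1" and S: "S \<in> sets borel"
    and sub: "\<And>u. u \<in> K \<Longrightarrow> v + l *\<^sub>R (u - v) \<in> S"
  shows "l ^ DIM('a) \<le> measure (uniform_on K) S"
proof -
  have vA: "v \<in> affine hull K" using v by (rule hull_inc)
  have Ys: "Y \<in> sets borel" using compact_thickening by (rule borel_compact)
  have PS: "P -` S \<in> sets borel" using measurable_sets[OF measurable_proj S] by simp
  define h where "h y = v + l *\<^sub>R (y - v)" for y
  have Ph: "P (h y) = h (P y)" for y
    unfolding h_def using vA l by (intro closest_point_homothety) auto
  have h_sub: "h ` Y \<subseteq> Y \<inter> P -` S"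
  proof
    fix z assume "z \<in> h ` Y"
    then obtain y where z: "z = h y" and y: "P y \<in> K" "dist y (P y) \<le> 1" by auto
    have "h (P y) = (1 - l) *\<^sub>R v + l *\<^sub>R P y" by (simp add: h_def algebra_simps)
    then have mem: "P (h y) \<in> K" using K v y l unfolding Ph by (simp add: convexD)
    have "dist (h y) (h (P y)) = l * dist y (P y)"
      using l by (simp add: h_def dist_norm flip: scaleR_right_diff_distrib)
    also have "\<dots> \<le> 1" using l y by (simp add: mult_le_one)
    finally have "dist (h y) (P (h y)) \<le> 1" unfolding Ph .
    moreover have "P (h y) \<in> S" unfolding Ph using sub[OF y(1)] by (simp add: h_def)
    ultimately show "z \<in> Y \<inter> P -` S" using mem z by simp
  qed
  have "h = (\<lambda>y. l *\<^sub>R y + (1 - l) *\<^sub>R v)" by (auto simp: h_def algebra_simps)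
  then have "measure lebesgue (h ` Y) = l ^ DIM('a) * measure lebesgue Y"
    using measure_lebesgue_affine[of l "(1 - l) *\<^sub>R v" Y] l by simp
  moreover have "measure lebesgue Y = measure lborel Y" using Ys by simp
  moreover have hY: "h ` Y \<in> sets borel"
    using compact_thickening
    by (intro borel_compact compact_continuous_image) (auto simp: h_def intro!: continuous_intros)
  ultimately have eq: "measure lborel (h ` Y) = l ^ DIM('a) * measure lborel Y" by simp
  have "measure lborel (h ` Y) \<le> measure lborel (Y \<inter> P -` S)"
  proof (rule measure_mono_fmeasurable[OF h_sub])
    show "h ` Y \<in> sets lborel" using hY by simp
    have "emeasure lborel (Y \<inter> P -` S) \<le> emeasure lborel Y"
      using Ys by (intro emeasure_mono) auto
    then show "Y \<inter> P -` S \<in> fmeasurable lborel"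
      using emeasure_thickening Ys PS by (auto simp: fmeasurable_def less_top[symmetric] top_unique)
  qed
  moreover have pos: "measure lborel Y > 0"
    using emeasure_thickening
    by (simp add: measure_def enn2real_positive_iff less_top[symmetric] zero_less_iff_neq_zero)
  ultimately have "l ^ DIM('a) \<le> measure lborel (Y \<inter> P -` S) / measure lborel Y"
    unfolding eq by (simp add: field_simps)
  also have "\<dots> = measure (uniform_measure lborel Y) (P -` S)"
    using emeasure_thickening Ys PS by (subst measure_uniform_measure) auto
  also have "\<dots> = measure (uniform_on K) S"
    unfolding uniform_on_def Let_def using measurable_proj S by (subst measure_distr) auto
  finally show ?thesis .
qed

end

subsection \<open>Consistent values\<close>

lemma optimal_arm_utility_ge: "utility u c t i \<le> utility u c t (optimal_arm u c t)"
proof -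
  have "Max (range (utility u c t)) \<in> range (utility u c t)" by (intro Max_in) auto
  then obtain x where "utility u c t x = Max (range (utility u c t))" by force
  then have "is_arg_max (utility u c t) (\<lambda>_. True) x" by (simp add: is_arg_max_linorder)
  then have "is_arg_max (utility u c t) (\<lambda>_. True) (optimal_arm u c t)"
    unfolding optimal_arm_def arg_max_def by (rule someI)
  then show ?thesis by (simp add: is_arg_max_linorder)
qed

text \<open>The least admissible \<open>r\<close> is the regret of \<open>u\<close> itself, a
  maximum over arms. Quantifying over all choices \<open>h\<close> of comparison arms replaces the
  maximum by linear inequalities in \<open>u\<close>, which makes closedness and convexity
  immediate.\<close>

lemma consistent_values_eq:
  "consistent_values f c a t =
     {u. (\<forall>i. 0 \<le> u $ i \<and> u $ i \<le> 1) \<and>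
         (\<forall>l\<in>{1..<t}. \<forall>h. (\<Sum>j = 1..l. utility u c j (h j) - utility u c j (a j)) \<le> f l)}"
  (is "?L = ?R")
proof (intro equalityI subsetI)
  fix u assume "u \<in> ?L"
  then obtain r where u: "\<forall>i. 0 \<le> u $ i \<and> u $ i \<le> 1"
    and r: "\<And>l i. l \<in> {1..<t} \<Longrightarrow> utility u c l i - r l \<le> utility u c l (a l)"
      "\<And>l. l \<in> {1..<t} \<Longrightarrow> (\<Sum>j = 1..l. r j) \<le> f l"
    unfolding consistent_values_def by blast
  have "(\<Sum>j = 1..l. utility u c j (h j) - utility u c j (a j)) \<le> f l" if l: "l \<in> {1..<t}" for l h
  proof -
    have "(\<Sum>j = 1..l. utility u c j (h j) - utility u c j (a j)) \<le> (\<Sum>j = 1..l. r j)"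
    proof (rule sum_mono)
      fix j assume "j \<in> {1..l}"
      then show "utility u c j (h j) - utility u c j (a j) \<le> r j"
        using r(1)[of j "h j"] l by simp
    qed
    then show ?thesis using r(2)[OF l] by simp
  qed
  then show "u \<in> ?R" using u by blast
next
  fix u assume u: "u \<in> ?R"
  have "\<exists>r. (\<forall>l\<in>{1..<t}. \<forall>i. utility u c l (a l) \<ge> utility u c l i - r l) \<and>
            (\<forall>l\<in>{1..<t}. (\<Sum>j = 1..l. r j) \<le> f l)"
  proof (intro exI[of _ "agent_regret u c a"] conjI ballI allI)
    fix l i
    show "utility u c l (a l) \<ge> utility u c l i - agent_regret u c a l"
      using optimal_arm_utility_ge[of u c l i] by (simp add: agent_regret_def)
  next
    fix l assume "l \<in> {1..<t}"
    then show "(\<Sum>j = 1..l. agent_regret u c a j) \<le> f l"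
      using u by (auto simp: agent_regret_def)
  qed
  then show "u \<in> ?L" using u by (simp add: consistent_values_def)
qed

lemma consistent_values_subset_box: "consistent_values f c a t \<subseteq> cbox 0 1"
  by (auto simp: consistent_values_def mem_box_cart)

lemma closed_consistent_values: "closed (consistent_values f c a t)"
  unfolding consistent_values_eq utility_def Ball_def
  by (intro closed_Collect_conj closed_Collect_all closed_Collect_imp open_Collect_const
      closed_Collect_le continuous_intros)

lemma compact_consistent_values: "compact (consistent_values f c a t)"
  using closed_consistent_values consistent_values_subset_box
  by (metis bounded_cbox bounded_subset compact_eq_bounded_closed)

lemma convex_consistent_values:
  fixes c :: "nat \<Rightarrow> real ^ 'k::finite"
  shows "convex (consistent_values f c a t)"
proof (rule convexI)
  fix x y :: "real ^ 'k" and p q :: real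
  assume xy: "x \<in> consistent_values f c a t" "y \<in> consistent_values f c a t"
    and pq: "0 \<le> p" "0 \<le> q" "p + q = 1"
  have comb: "utility (p *\<^sub>R x + q *\<^sub>R y) c t i = p * utility x c t i + q * utility y c t i" for t i
  proof -
    have "c t $ i = (p + q) * c t $ i" using pq by simp
    then show ?thesis by (simp add: utility_def algebra_simps)
  qed
  have "0 \<le> (p *\<^sub>R x + q *\<^sub>R y) $ i \<and> (p *\<^sub>R x + q *\<^sub>R y) $ i \<le> 1" for i
    using xy pq convex_bound_le[of "x $ i" 1 "y $ i" p q] by (simp add: consistent_values_eq)
  moreover have "(\<Sum>j = 1..l. utility (p *\<^sub>R x + q *\<^sub>R y) c j (h j) - utility (p *\<^sub>R x + q *\<^sub>R y) c j (a j)) \<le> f l"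
    if "l \<in> {1..<t}" for l h
  proof -
    have "(\<Sum>j = 1..l. utility (p *\<^sub>R x + q *\<^sub>R y) c j (h j) - utility (p *\<^sub>R x + q *\<^sub>R y) c j (a j))
       = p * (\<Sum>j = 1..l. utility x c j (h j) - utility x c j (a j))
         + q * (\<Sum>j = 1..l. utility y c j (h j) - utility y c j (a j))"
      unfolding comb by (simp add: sum_distrib_left algebra_simps flip: sum.distrib)
    also have "\<dots> \<le> f l"
      using xy pq that by (intro convex_bound_le) (auto simp: consistent_values_eq)
    finally show ?thesis .
  qed
  ultimately show "p *\<^sub>R x + q *\<^sub>R y \<in> consistent_values f c a t"
    unfolding consistent_values_eq by blast
qed

text \<open>Comparing with \<open>b i\<close> only at the steps of \<open>L\<close> where this
  gains, and with \<open>a i\<close> elsewhere, leaves exactly the positive parts; all other terms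
  vanish.\<close>

lemma consistent_values_sum_le:
  assumes u: "u \<in> consistent_values f c a t" and L: "L \<subseteq> {1..<t}" and t: "2 \<le> t"
  shows "(\<Sum>i\<in>L. max 0 (utility u c i (b i) - utility u c i (a i))) \<le> f (t - 1)"
proof -
  define h where "h i = (if i \<in> L \<and> utility u c i (a i) \<le> utility u c i (b i) then b i else a i)" for i
  have eq: "(\<Sum>i = 1..t - 1. utility u c i (h i) - utility u c i (a i)) \<le> f (t - 1)"
    using u t by (auto simp: consistent_values_eq)
  have "(\<Sum>i\<in>L. max 0 (utility u c i (b i) - utility u c i (a i)))
      = (\<Sum>i\<in>L. utility u c i (h i) - utility u c i (a i))"
    by (intro sum.cong) (auto simp: h_def)
  also have "\<dots> = (\<Sum>i = 1..t - 1. utility u c i (h i) - utility u c i (a i))"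
    using L t by (intro sum.mono_neutral_left) (fastforce simp: h_def)+
  finally show ?thesis using eq by simp
qed

text \<open>
  The prediction \<open>p\<close> has at least the weight of \<open>b\<close>, so the region where \<open>b\<close> is strictly optimal
  has probability at most \<open>1 / 2\<close>. It cannot contain a copy of the consistent values shrunk
  towards \<open>v\<close> by a factor whose \<open>CARD('k)\<close>-th power exceeds \<open>1 / 2\<close>.
\<close>

lemma mispredicted_arm_witness:
  fixes v :: "real ^ 'k::finite"
  assumes v: "v \<in> consistent_values f c a t"
    and pred: "\<And>i. optimality_prob f c a t i \<le> optimality_prob f c a t p"
    and "p \<noteq> b" and l: "0 < l" "l ^ CARD('k) = 1 / 2"
    and best: "\<And>j. j \<noteq> b \<Longrightarrow> utility v c t j < utility v c t b"
  obtains j u where "j \<noteq> b" "u \<in> consistent_values f c a t"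
    "utility v c t b - utility v c t j \<le> l * ((u $ j - u $ b) - (v $ j - v $ b))"
proof (rule ccontr)
  note thesisI = that
  assume contr: "\<not> thesis"
  let ?K = "consistent_values f c a t"
  define \<gamma> where "\<gamma> j = utility v c t b - utility v c t j" for j
  define g where "g j u = (u $ j - u $ b) - (v $ j - v $ b)" for j and u :: "real ^ 'k"
  have less: "l * g j u < \<gamma> j" if "j \<noteq> b" "u \<in> ?K" for j u
    using contr thesisI[OF that] by (auto simp: \<gamma>_def g_def not_le[symmetric])
  have l1: "l < 1"
  proof (rule ccontr)
    assume "\<not> l < 1"
    then have "1 \<le> l ^ CARD('k)" by (intro one_le_power) simp
    then show False using l by simp
  qed
  \<comment> \<open>Compactness leaves slack in the strict inequalities, so a factor above
    \<open>l\<close> still works. The excess is what lifts the probability strictly above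
    1/2.\<close>
  have "\<exists>m. l < m \<and> m < 1 \<and> (\<forall>u\<in>?K. m * g j u < \<gamma> j)" if j: "j \<noteq> b" for j
  proof -
    have "continuous_on ?K (g j)" unfolding g_def by (intro continuous_intros)
    then obtain x where x: "x \<in> ?K" "\<And>u. u \<in> ?K \<Longrightarrow> g j u \<le> g j x"
      using continuous_attains_sup[OF compact_consistent_values, of f c a t "g j"] v by auto
    have "0 \<le> g j x" using x(2)[OF v] by (simp add: g_def)
    show ?thesis
    proof (cases "g j x = 0")
      case True
      have "((l + 1) / 2) * g j u < \<gamma> j" if "u \<in> ?K" for u
      proof -
        have "((l + 1) / 2) * g j u \<le> 0" using x(2)[OF that] True l by (simp add: mult_le_0_iff)
        also have "0 < \<gamma> j" using best[OF j] by (simp add: \<gamma>_def)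
        finally show ?thesis .
      qed
      then show ?thesis using l1 by (intro exI[of _ "(l + 1) / 2"]) auto
    next
      case False
      with \<open>0 \<le> g j x\<close> have gx: "0 < g j x" by simp
      then have "l < \<gamma> j / g j x" using less[OF j x(1)] by (simp add: field_simps)
      then obtain m where m: "l < m" "m < min 1 (\<gamma> j / g j x)"
        using l1 dense[of l "min 1 (\<gamma> j / g j x)"] by auto
      have "m * g j u < \<gamma> j" if "u \<in> ?K" for u
      proof -
        have "m * g j u \<le> m * g j x" using x(2)[OF that] m l by (intro mult_left_mono) auto
        also have "\<dots> < \<gamma> j" using m gx by (simp add: field_simps)
        finally show ?thesis .
      qed
      then show ?thesis using m by auto
    qed
  qed
  then obtain m where m: "\<And>j. j \<noteq> b \<Longrightarrow> l < m j \<and> m j < 1 \<and> (\<forall>u\<in>?K. m j * g j u < \<gamma> j)"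
    by metis
  define M where "M = Min (m ` (UNIV - {b}))"
  have ne: "m ` (UNIV - {b}) \<noteq> {}" using \<open>p \<noteq> b\<close> by auto
  then have "M \<in> m ` (UNIV - {b})" unfolding M_def by (intro Min_in) auto
  then have M: "l < M" "M < 1" using m by auto
  have M_le: "M \<le> m j" if "j \<noteq> b" for j unfolding M_def using that by (intro Min_le) auto
  \<comment> \<open>Strict optimality of \<open>b\<close> puts \<open>S\<close> inside the region of
    \<open>b\<close> and makes it disjoint from the region of \<open>p\<close>, ties
    included.\<close>
  define S where "S = {u. \<forall>j\<in>UNIV - {b}. utility u c t j < utility u c t b}"
  have Sopen: "open S"
  proof -
    have "S = (\<Inter>j\<in>UNIV - {b}. {u. utility u c t j < utility u c t b})" by (auto simp: S_def)
    also have "open \<dots>"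
      unfolding utility_def by (intro open_INT open_Collect_less continuous_intros ballI) auto
    finally show ?thesis .
  qed
  interpret prob_space "uniform_on ?K"
    using v by (intro prob_space_uniform_on compact_consistent_values convex_consistent_values) auto
  have sets[simp]: "sets (uniform_on ?K) = sets borel" by (simp add: uniform_on_def Let_def)
  have space: "space (uniform_on ?K) = UNIV" by (simp add: uniform_on_def Let_def)
  let ?A = "\<lambda>i. {u. \<forall>j. utility u c t i \<ge> utility u c t j}"
  have Acl: "?A i \<in> sets borel" for i
    unfolding utility_def by (intro borel_closed closed_Collect_all closed_Collect_le continuous_intros)
  have "M ^ DIM(real ^ 'k) \<le> prob S"
  proof (rule measure_uniform_on_homothety_ge)
    fix u assume u: "u \<in> ?K"
    have "utility (v + M *\<^sub>R (u - v)) c t j < utility (v + M *\<^sub>R (u - v)) c t b" if j: "j \<noteq> b" for j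
    proof -
      have "M * g j u < \<gamma> j"
      proof (cases "g j u \<le> 0")
        case True
        then have "M * g j u \<le> 0" using M l by (simp add: mult_le_0_iff)
        then show ?thesis using best[OF j] by (simp add: \<gamma>_def)
      next
        case False
        then have "M * g j u \<le> m j * g j u" using M_le[OF j] by (intro mult_right_mono) auto
        then show ?thesis using m[OF j] u by fastforce
      qed
      then show ?thesis by (simp add: \<gamma>_def g_def utility_def algebra_simps)
    qed
    then show "v + M *\<^sub>R (u - v) \<in> S" by (simp add: S_def)
  qed (use v M l Sopen compact_consistent_values convex_consistent_values in auto)
  moreover have "l ^ CARD('k) < M ^ CARD('k)"
    using M l by (intro power_strict_mono) auto
  ultimately have S_gt: "1 / 2 < prob S" using l by simp
  have "utility u c t j \<le> utility u c t b" if "u \<in> S" for u j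
    using that by (cases "j = b") (auto simp: S_def less_imp_le)
  then have "prob S \<le> prob (?A b)"
    using Acl by (intro finite_measure_mono) auto
  also have "\<dots> \<le> prob (?A p)" using pred[of b] by (simp add: optimality_prob_def)
  also have "\<dots> \<le> prob (space (uniform_on ?K) - S)"
  proof (rule finite_measure_mono)
    have "u \<notin> S" if "u \<in> ?A p" for u
      using that \<open>p \<noteq> b\<close> by (auto simp: S_def not_less intro!: bexI[of _ p])
    then show "?A p \<subseteq> space (uniform_on ?K) - S" by (auto simp: space)
    show "space (uniform_on ?K) - S \<in> events" using Sopen by (intro sets.compl_sets) simp
  qed
  also have "\<dots> = 1 - prob S" using Sopen by (intro prob_compl) auto
  finally show False using S_gt by simp
qed

subsection \<open>Counting cuts along one direction\<close>

text \<open>The antiderivative is \<open>ln y + l * D / y\<close>. Scaling \<open>y\<close> by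
  \<open>D\<close> removes \<open>D\<close> from the integral, so only \<open>l\<close> survives in
  the value.\<close>

lemma has_integral_wedge:
  fixes D l :: real
  assumes "0 < l" "l \<le> 1" "0 < D" "\<delta> \<le> l * D" "D \<le> B"
  shows "((\<lambda>y. if y \<in> {l * D..D} then (y - l * D) / y\<^sup>2 else 0)
           has_integral (- ln l - (1 - l))) {\<delta>..B}"
proof -
  have lD: "0 < l * D" "l * D \<le> D" using assms by (auto simp: mult_le_cancel_right1)
  have "((\<lambda>y. (y - l * D) / y\<^sup>2) has_integral
          ((ln D + l * D / D) - (ln (l * D) + l * D / (l * D)))) {l * D..D}"
  proof (rule fundamental_theorem_of_calculus)
    fix y assume "y \<in> {l * D..D}"
    then have "y > 0" using lD by auto
    then show "((\<lambda>y. ln y + l * D / y) has_vector_derivative (y - l * D) / y\<^sup>2)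
                 (at y within {l * D..D})"
      unfolding has_real_derivative_iff_has_vector_derivative[symmetric]
      by (auto intro!: derivative_eq_intros simp: field_simps power2_eq_square)
  qed (use lD in auto)
  moreover have "(ln D + l * D / D) - (ln (l * D) + l * D / (l * D)) = - ln l - (1 - l)"
    using assms by (simp add: ln_mult)
  ultimately have "((\<lambda>y. (y - l * D) / y\<^sup>2) has_integral (- ln l - (1 - l))) (cbox (l * D) D)"
    by simp
  then have "((\<lambda>y. if y \<in> cbox (l * D) D then (y - l * D) / y\<^sup>2 else 0)
      has_integral (- ln l - (1 - l))) (cbox \<delta> B)"
    using assms by (intro has_integral_restrict_closed_subinterval) (auto simp: cbox_interval)
  then show ?thesis by (simp add: cbox_interval)
qed

text \<open>
  Scale-invariant counting: a point at distance \<open>y\<close> from the true values pays at least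
  \<open>y - l * D i\<close> for every \<open>i\<close> with \<open>l * D i \<le> y \<le> D i\<close>. Averaging this over \<open>y\<close> with density
  \<open>1 / y\<^sup>2\<close> makes the contribution of each \<open>i\<close> independent of \<open>D i\<close>.
\<close>

lemma card_cuts_le:
  fixes D \<gamma> :: "nat \<Rightarrow> real"
  assumes L: "finite L" and l: "0 < l" "l \<le> 1" and "0 < \<delta>" "\<delta> \<le> B"
    and \<gamma>: "\<And>i. i \<in> L \<Longrightarrow> \<delta> \<le> \<gamma> i \<and> \<gamma> i \<le> l * D i \<and> D i \<le> B"
    and budget: "\<And>m. m \<in> L \<Longrightarrow> (\<Sum>i\<in>{i\<in>L. i < m}. max 0 (D m - \<gamma> i)) \<le> F"
    and F: "0 \<le> F"
  shows "real (card L) * (- ln l - (1 - l)) \<le> F / \<delta> + (1 - l) * ln (B / \<delta>)"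
proof -
  define w where "w i y = (if y \<in> {l * D i..D i} then (y - l * D i) / y\<^sup>2 else 0)" for i and y :: real
  have Dpos: "0 < D i" if "i \<in> L" for i
    using \<gamma>[OF that] l \<open>0 < \<delta>\<close> by (metis less_le_trans order_less_le_trans zero_less_mult_pos)
  have "(w i has_integral (- ln l - (1 - l))) {\<delta>..B}" if "i \<in> L" for i
    unfolding w_def using \<gamma>[OF that] Dpos[OF that] l by (intro has_integral_wedge) auto
  then have lhs: "((\<lambda>y. \<Sum>i\<in>L. w i y) has_integral (\<Sum>i\<in>L. - ln l - (1 - l))) {\<delta>..B}"
    using L by (intro has_integral_sum)
  have "((\<lambda>y. F / y\<^sup>2 + (1 - l) / y) has_integral
          ((- F / B + (1 - l) * ln B) - (- F / \<delta> + (1 - l) * ln \<delta>))) {\<delta>..B}"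
  proof (rule fundamental_theorem_of_calculus)
    fix y assume "y \<in> {\<delta>..B}"
    then have "y > 0" using \<open>0 < \<delta>\<close> by auto
    then show "((\<lambda>y. - F / y + (1 - l) * ln y) has_vector_derivative F / y\<^sup>2 + (1 - l) / y)
                 (at y within {\<delta>..B})"
      unfolding has_real_derivative_iff_has_vector_derivative[symmetric]
      by (auto intro!: derivative_eq_intros simp: field_simps power2_eq_square)
  qed (use assms in auto)
  with lhs have "(\<Sum>i\<in>L. - ln l - (1 - l)) \<le> (- F / B + (1 - l) * ln B) - (- F / \<delta> + (1 - l) * ln \<delta>)"
  proof (rule has_integral_le)
    fix y assume "y \<in> {\<delta>..B}"
    then have y: "y > 0" using \<open>0 < \<delta>\<close> by auto
    define A where "A = {i \<in> L. y \<le> D i}"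
    have "(\<Sum>i\<in>L. w i y) * y\<^sup>2 = (\<Sum>i\<in>L. w i y * y\<^sup>2)" by (simp add: sum_distrib_right)
    also have "\<dots> = (\<Sum>i\<in>A. w i y * y\<^sup>2)"
      unfolding A_def using L by (intro sum.mono_neutral_right) (auto simp: w_def)
    also have "\<dots> \<le> F + (1 - l) * y"
    proof (cases "A = {}")
      case True
      then show ?thesis using F l y by simp
    next
      case False
      have fin: "finite A" using L by (simp add: A_def)
      \<comment> \<open>The last index \<open>m\<close> of \<open>A\<close> has \<open>D m\<close>
        at least \<open>y\<close>, so its budget pays for all earlier indices in \<open>A\<close>.
        The budget omits \<open>m\<close> itself, whose term is at most \<open>(1 - l) * y\<close>;
        this is the source of the logarithm in the bound.\<close>
      define m where "m = Max A"
      have m: "m \<in> A" using False fin by (simp add: m_def)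
      have mD: "y \<le> D m" "m \<in> L" using m by (auto simp: A_def)
      have wm: "w m y * y\<^sup>2 \<le> (1 - l) * y"
      proof -
        have "l * y \<le> l * D m" using mD l by simp
        moreover have "w m y * y\<^sup>2 = (if y \<in> {l * D m..D m} then y - l * D m else 0)"
          using y by (simp add: w_def)
        moreover have "(1 - l) * y = y - l * y" by (simp add: algebra_simps)
        moreover have "0 \<le> (1 - l) * y" using l y by simp
        ultimately show ?thesis by simp
      qed
      have "(\<Sum>i\<in>A - {m}. w i y * y\<^sup>2) \<le> (\<Sum>i\<in>A - {m}. max 0 (D m - \<gamma> i))"
      proof (rule sum_mono)
        fix i assume "i \<in> A - {m}"
        then have "\<gamma> i \<le> l * D i" using \<gamma>[of i] by (auto simp: A_def)
        then show "w i y * y\<^sup>2 \<le> max 0 (D m - \<gamma> i)" using mD y by (auto simp: w_def)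
      qed
      also have "\<dots> \<le> (\<Sum>i\<in>{i\<in>L. i < m}. max 0 (D m - \<gamma> i))"
      proof (rule sum_mono2)
        show "A - {m} \<subseteq> {i\<in>L. i < m}"
          using fin by (auto simp: A_def m_def less_le)
      qed (use L in auto)
      also have "\<dots> \<le> F" using mD by (intro budget)
      finally show ?thesis using wm fin m by (simp add: sum.remove)
    qed
    finally show "(\<Sum>i\<in>L. w i y) \<le> F / y\<^sup>2 + (1 - l) / y"
      using y by (simp add: field_simps power2_eq_square)
  qed
  moreover have "ln (B / \<delta>) = ln B - ln \<delta>" using assms by (simp add: ln_div)
  moreover have "0 \<le> F / B" using assms by simp
  ultimately show ?thesis by (simp add: right_diff_distrib)
qed

subsection \<open>The mistake bound\<close>

text \<open>The difference of the two sides vanishes at 0, and its derivative is nonnegative by the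
  quadratic upper bound. This later bounds \<open>x - (1 - exp (- x))\<close> below by
  \<open>x\<^sup>2 / 2 - x ^ 3 / 6\<close>.\<close>

lemma exp_minus_lower_cubic:
  fixes x :: real
  assumes "0 \<le> x"
  shows "1 - x + x\<^sup>2 / 2 - x ^ 3 / 6 \<le> exp (- x)"
proof -
  \<comment> \<open>Multiplying the right side by the quadratic Taylor minorant of
    \<open>exp y\<close> gives \<open>1 + y ^ 4 / 4\<close>, which is at least 1.\<close>
  have upper: "exp (- y) \<le> 1 - y + y\<^sup>2 / 2" if "0 \<le> y" for y :: real
  proof -
    have pos: "0 \<le> 1 - y + y\<^sup>2 / 2"
      using zero_le_power2[of "y - 1"] by (simp add: power2_eq_square algebra_simps)
    have "1 \<le> 1 + y ^ 4 / 4" by simp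
    also have "\<dots> = (1 - y + y\<^sup>2 / 2) * (1 + y + y\<^sup>2 / 2)" by (simp add: eval_nat_numeral field_simps)
    also have "\<dots> \<le> (1 - y + y\<^sup>2 / 2) * exp y"
      using pos exp_lower_Taylor_quadratic[OF that] by (rule mult_left_mono[rotated])
    finally show ?thesis by (simp add: exp_minus field_simps)
  qed
  define h where "h y = exp (- y) - (1 - y + y\<^sup>2 / 2 - y ^ 3 / 6)" for y :: real
  have "h 0 \<le> h x"
  proof (rule DERIV_nonneg_imp_nondecreasing[OF assms])
    fix y :: real assume "0 \<le> y" "y \<le> x"
    have "(h has_real_derivative (- exp (- y) + (1 - y + y\<^sup>2 / 2))) (at y)"
      unfolding h_def by (auto intro!: derivative_eq_intros simp: field_simps)
    then show "\<exists>z. (h has_real_derivative z) (at y) \<and> 0 \<le> z" using upper[OF \<open>0 \<le> y\<close>] by auto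
  qed
  then show "1 - x + x\<^sup>2 / 2 - x ^ 3 / 6 \<le> exp (- x)" by (simp add: h_def)
qed

lemma ln_ge_of_power2_le:
  assumes "2 ^ n \<le> (T :: real)"
  shows "real n * (2 / 3) \<le> ln T"
proof -
  have "real n * (2 / 3) \<le> real n * ln 2" by (intro mult_left_mono ln2_ge_two_thirds) simp
  also have "\<dots> = ln (2 ^ n)" by (simp add: ln_realpow)
  also have "\<dots> \<le> ln T" using assms by (intro ln_mono) (auto intro: less_le_trans)
  finally show ?thesis .
qed

text \<open>Bootstrapping: a lower bound on \<open>ln T\<close> gives one on \<open>T\<close>, hence a better one on \<open>ln T\<close>.\<close>

lemma rounds_lower_bound:
  fixes T :: real
  assumes k: "2 \<le> k" and T: "2 \<le> T" "real k ^ 4 * ln T < 2 * T"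
  shows "8 / 3 \<le> ln T" and "3 \<le> k \<Longrightarrow> 5 \<le> ln T"
proof -
  note ln_ge = ln_ge_of_power2_le[of _ T]
  have step: "real k ^ 4 * y < 2 * T" if "y \<le> ln T" for y
    using T(2) mult_left_mono[OF that, of "real k ^ 4"] by simp
  have "2 ^ 4 * y \<le> real k ^ 4 * y" if "0 \<le> y" for y
    using k that by (intro mult_right_mono power_mono) auto
  then have step2: "8 * y < T" if "0 \<le> y" "y \<le> ln T" for y
    using step[OF that(2)] that(1) by fastforce
  have "2 / 3 \<le> ln T" using ln_ge[of 1] T by simp
  from step2[OF _ this] have "4 / 3 \<le> ln T" using ln_ge[of 2] by simp
  from step2[OF _ this] have "2 \<le> ln T" using ln_ge[of 3] by simp
  from step2[OF _ this] show "8 / 3 \<le> ln T" using ln_ge[of 4] by simp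
  assume k3: "3 \<le> k"
  have "3 ^ 4 * y \<le> real k ^ 4 * y" if "0 \<le> y" for y
    using k3 that by (intro mult_right_mono power_mono) auto
  then have step3: "81 * y < 2 * T" if "0 \<le> y" "y \<le> ln T" for y
    using step[OF that(2)] that(1) by fastforce
  from step3[OF _ \<open>8 / 3 \<le> ln T\<close>] have "4 \<le> ln T" using ln_ge[of 6] by simp
  from step3[OF _ this] have "14 / 3 \<le> ln T" using ln_ge[of 7] by simp
  from step3[OF _ this] have "189 \<le> T" by simp
  \<comment> \<open>Since \<open>ln 2\<close> is replaced by 2/3, reaching 5 takes the exponent
    15/2; squaring avoids the half-integral power.\<close>
  then have "189 ^ 2 \<le> T ^ 2" by (intro power_mono) auto
  then have "2 ^ 15 \<le> T ^ 2" by simp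
  from ln_ge_of_power2_le[OF this] show "5 \<le> ln T" using T by (simp add: ln_realpow)
qed

text \<open>
  With shrinking factor \<open>exp (- x) = 2 powr (- 1 / k)\<close>, this is the numerical condition under which
  the \<open>k * (k - 1)\<close> per-pair bounds from \<open>card_cuts_le\<close> add up to at most \<open>k ^ 4\<close> times \<open>ln T\<close>.
\<close>

lemma pair_count_factor:
  fixes T :: real
  assumes k: "2 \<le> k" and T: "2 \<le> T" "real k ^ 4 * ln T < 2 * T"
  defines "x \<equiv> ln 2 / real k"
  shows "real k - 1 \<le> (x - (1 - exp (- x))) * real k ^ 3 * ln T"
proof -
  have x: "0 \<le> x" "x * real k = ln 2" using k by (auto simp: x_def)
  \<comment> \<open>A rational upper bound for \<open>x\<close>. With \<open>ln T\<close> at least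
    8/3 or 5 respectively, the product \<open>2 / 9 * (1 - y / 3) * (real k * ln T)\<close> is at
    least 416/405 for \<open>k = 2\<close> and \<open>55 / 54 * k\<close> otherwise, just enough for
    \<open>k - 1\<close>.\<close>
  define y where "y = (if k = 2 then 2 / 5 else 1 / 4 :: real)"
  have "x \<le> y"
  proof (cases "k = 2")
    case True
    then show ?thesis using ln2_le_25_over_36 by (simp add: x_def y_def)
  next
    case False
    then have "3 \<le> real k" using k by simp
    then have "x \<le> ln 2 / 3" unfolding x_def by (intro divide_left_mono) auto
    then show ?thesis using ln2_le_25_over_36 False by (simp add: y_def)
  qed
  have lnT: "0 \<le> ln T" using T by simp
  have "(2 / 3)\<^sup>2 \<le> (ln 2 :: real)\<^sup>2" using ln2_ge_two_thirds by (intro power_mono) auto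
  then have "2 / 9 * (1 - y / 3) \<le> ((ln 2)\<^sup>2 / 2) * (1 - x / 3)"
    using \<open>x \<le> y\<close> by (intro mult_mono) (auto simp: power2_eq_square y_def split: if_splits)
  also have "\<dots> = (x\<^sup>2 / 2 - x ^ 3 / 6) * (real k)\<^sup>2"
    unfolding x(2)[symmetric] by (simp add: power2_eq_square power3_eq_cube field_simps)
  also have "\<dots> \<le> (x - (1 - exp (- x))) * (real k)\<^sup>2"
    using exp_minus_lower_cubic[OF x(1)] by (intro mult_right_mono) auto
  finally have c: "2 / 9 * (1 - y / 3) \<le> (x - (1 - exp (- x))) * (real k)\<^sup>2" .
  have "real k - 1 \<le> 2 / 9 * (1 - y / 3) * (real k * ln T)"
  proof (cases "k = 2")
    case True
    then show ?thesis using rounds_lower_bound(1)[OF k T] by (simp add: y_def)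
  next
    case False
    then have "real k * 5 \<le> real k * ln T"
      using rounds_lower_bound(2)[OF k T] k by (intro mult_left_mono) auto
    then show ?thesis using False by (simp add: y_def)
  qed
  also have "\<dots> \<le> (x - (1 - exp (- x))) * (real k)\<^sup>2 * (real k * ln T)"
    using c lnT by (intro mult_right_mono) auto
  finally show ?thesis by (simp add: power2_eq_square power3_eq_cube mult_ac)
qed

theorem theorem2:
  fixes v :: "real ^ 'k::finite" and c :: "nat \<Rightarrow> real ^ 'k"
    and a p :: "nat \<Rightarrow> 'k" and f :: "nat \<Rightarrow> real" and \<delta> :: real and T :: nat
  assumes v_range: "\<And>i. 0 \<le> v $ i \<and> v $ i \<le> 1"
    and f_mono: "mono_on {1..} f"
    and regret: "\<And>n. n \<ge> 1 \<Longrightarrow> (\<Sum>t = 1..n. agent_regret v c a t) \<le> f n"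
    and delta_pos: "\<delta> > 0"
    and gap: "\<And>t j. t \<ge> 1 \<Longrightarrow> j \<noteq> optimal_arm v c t \<Longrightarrow>
                utility v c t (optimal_arm v c t) \<ge> utility v c t j + \<delta>"
    and prediction: "prediction_algorithm f c a p"
    and T: "T \<ge> 2"
  shows "real (card {t \<in> {1..T}. p t \<noteq> a t})
           \<le> (real CARD('k) ^ 4 * (f T + 1) * ln (real T) + f T) / \<delta>"
proof -
  define k where "k = CARD('k)"
  define F where "F = f T"
  let ?o = "optimal_arm v c"
  let ?K = "consistent_values f c a"
  have regret_nonneg: "0 \<le> agent_regret v c a t" for t
    using optimal_arm_utility_ge[of v c t "a t"] by (simp add: agent_regret_def)
  have "0 \<le> (\<Sum>t = 1..T. agent_regret v c a t)" by (intro sum_nonneg regret_nonneg)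
  then have F: "0 \<le> F" using regret[of T] T by (simp add: F_def)
  have v: "v \<in> ?K t" for t
    unfolding consistent_values_def using v_range regret
    by (auto simp: agent_regret_def intro!: exI[of _ "agent_regret v c a"] optimal_arm_utility_ge)

  define M1 where "M1 = {t \<in> {1..T}. a t \<noteq> ?o t}"
  define M2 where "M2 = {t \<in> {1..T}. a t = ?o t \<and> p t \<noteq> a t}"
  have fin: "finite M1" "finite M2" by (auto simp: M1_def M2_def)
  have "real (card M1) * \<delta> = (\<Sum>t\<in>M1. \<delta>)" by simp
  also have "\<dots> \<le> (\<Sum>t\<in>M1. agent_regret v c a t)"
    using gap by (intro sum_mono) (fastforce simp: M1_def agent_regret_def)
  also have "\<dots> \<le> (\<Sum>t = 1..T. agent_regret v c a t)"
    using regret_nonneg by (intro sum_mono2) (auto simp: M1_def)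
  also have "\<dots> \<le> F" using regret[of T] T by (simp add: F_def)
  finally have M1: "real (card M1) \<le> F / \<delta>" using delta_pos by (simp add: field_simps)

  have M2: "real (card M2) \<le> real k ^ 4 * (F + 1) * ln T / \<delta>"
  proof (cases "M2 = {}")
    case True
    then show ?thesis using F T delta_pos by simp
  next
    case False
    have k: "2 \<le> k"
    proof -
      obtain t where "p t \<noteq> a t" using False unfolding M2_def by blast
      then have "card {p t, a t} = 2" by simp
      then show ?thesis unfolding k_def by (metis card_mono finite subset_UNIV)
    qed
    define x where "x = ln 2 / real k"
    define l where "l = exp (- x)"
    have x: "0 < x" "x \<le> 1 / 2"
    proof -
      show "0 < x" using k by (simp add: x_def)
      have "x \<le> ln 2 / 2" unfolding x_def using k by (intro divide_left_mono) auto
      then show "x \<le> 1 / 2" using ln2_le_25_over_36 by simp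
    qed
    have l: "0 < l" "l \<le> 1" "l ^ CARD('k) = 1 / 2"
    proof -
      have "l ^ CARD('k) = exp (- ln 2)"
        using k by (simp add: l_def x_def k_def flip: exp_of_nat_mult)
      then show "l ^ CARD('k) = 1 / 2" by (simp add: exp_minus)
    qed (use x in \<open>auto simp: l_def\<close>)
    have ln_l: "- ln l - (1 - l) = x - (1 - exp (- x))" by (simp add: l_def)

    have "\<exists>j u. j \<noteq> a t \<and> u \<in> ?K t \<and>
        utility v c t (a t) - utility v c t j \<le> l * ((u $ j - u $ a t) - (v $ j - v $ a t))"
      if t: "t \<in> M2" for t
    proof -
      have t': "1 \<le> t" "a t = ?o t" "p t \<noteq> a t" using t by (auto simp: M2_def)
      have pred: "optimality_prob f c a t i \<le> optimality_prob f c a t (p t)" for i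
        using prediction t'(1) by (auto simp: prediction_algorithm_def is_arg_max_linorder)
      have "utility v c t j < utility v c t (a t)" if "j \<noteq> a t" for j
        using gap[of t j] t' that delta_pos by simp
      from mispredicted_arm_witness[OF v pred t'(3) l(1,3) this] show ?thesis by metis
    qed
    then obtain arm u where w: "\<And>t. t \<in> M2 \<Longrightarrow> arm t \<noteq> a t \<and> u t \<in> ?K t \<and>
        utility v c t (a t) - utility v c t (arm t)
          \<le> l * ((u t $ arm t - u t $ a t) - (v $ arm t - v $ a t))"
      by metis
    define \<gamma> where "\<gamma> t = utility v c t (a t) - utility v c t (arm t)" for t
    define D where "D t = (u t $ arm t - u t $ a t) - (v $ arm t - v $ a t)" for t
    have bounds: "\<delta> \<le> \<gamma> t \<and> \<gamma> t \<le> l * D t \<and> D t \<le> 2" if t: "t \<in> M2" for t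
    proof -
      have "0 \<le> u t $ i \<and> u t $ i \<le> 1" for i
        using w[OF t] by (auto simp: consistent_values_def)
      from this[of "arm t"] this[of "a t"] v_range[of "arm t"] v_range[of "a t"]
      have "D t \<le> 2" by (simp add: D_def)
      then show ?thesis
        using w[OF t] gap[of t "arm t"] t by (auto simp: \<gamma>_def D_def M2_def)
    qed
    \<comment> \<open>A single witness already forces this, since \<open>\<delta>\<close> is at most
      \<open>l * D t\<close>.\<close>
    have "\<delta> \<le> 2"
    proof -
      obtain t where t: "t \<in> M2" using False by blast
      have "l * D t \<le> l * 2" using bounds[OF t] l by (intro mult_left_mono) auto
      then show ?thesis using bounds[OF t] l by linarith
    qed
    show ?thesis
    \<comment> \<open>If \<open>T\<close> is small compared with \<open>k ^ 4 * ln T\<close>,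
      counting all rounds suffices because \<open>\<delta> \<le> 2\<close>. Otherwise
      \<open>pair_count_factor\<close> applies.\<close>
    proof (cases "real k ^ 4 * ln T < 2 * real T")
      case False
      have "real (card M2) \<le> T"
      proof -
        have "card M2 \<le> card {1..T}" by (intro card_mono) (auto simp: M2_def)
        then show ?thesis by simp
      qed
      also have "\<dots> \<le> real k ^ 4 * ln T / 2" using False by simp
      also have "\<dots> \<le> real k ^ 4 * ln T / \<delta>"
        using \<open>\<delta> \<le> 2\<close> delta_pos T by (intro divide_left_mono) auto
      also have "\<dots> \<le> real k ^ 4 * (F + 1) * ln T / \<delta>"
        using F delta_pos T by (intro divide_right_mono mult_right_mono) (auto simp: mult_le_cancel_left1)
      finally show ?thesis .
    next
      case True
      define \<kappa> where "\<kappa> = x - (1 - exp (- x))"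
      have factor: "real k - 1 \<le> \<kappa> * real k ^ 3 * ln T"
        using pair_count_factor[of k "real T"] k True T by (simp add: \<kappa>_def x_def)
      have "\<kappa> > 0"
      proof (rule ccontr)
        assume "\<not> \<kappa> > 0"
        then have "\<kappa> * (real k ^ 3 * ln T) \<le> 0" using T by (intro mult_nonpos_nonneg) auto
        then show False using factor k by (simp add: mult_ac)
      qed
      define pair where "pair i = (arm i, a i)" for i
      define L where "L q = {i \<in> M2. pair i = q}" for q
      have L_le: "real (card (L q)) \<le> (F + 1) / (\<delta> * \<kappa>)" for q
      proof -
        obtain j b where q: "q = (j, b)" by fastforce
        have "real (card (L q)) * (- ln l - (1 - l)) \<le> F / \<delta> + (1 - l) * ln (2 / \<delta>)"
        proof (rule card_cuts_le)
          fix m assume m: "m \<in> L q"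
          have mT: "1 \<le> m" "m \<le> T" "u m \<in> ?K m" "arm m = j" "a m = b"
            using m w[of m] by (auto simp: L_def M2_def q pair_def)
          show "(\<Sum>i\<in>{i \<in> L q. i < m}. max 0 (D m - \<gamma> i)) \<le> F"
          \<comment> \<open>At the first step there is no past and hence nothing to pay. Treating it
            apart keeps \<open>f 0\<close> out of the argument.\<close>
          proof (cases "m = 1")
            case True
            then have "{i \<in> L q. i < m} = {}" by (auto simp: L_def M2_def)
            then show ?thesis unfolding \<open>{i \<in> L q. i < m} = {}\<close> using F by simp
          next
            case False
            \<comment> \<open>The true values cancel in \<open>D m - \<gamma> i\<close>. What
              remains is the advantage of \<open>j\<close> over \<open>b\<close> at step
              \<open>i\<close> under the values \<open>u m\<close>, so consistency of
              \<open>u m\<close> bounds the sum.\<close>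
            have "(\<Sum>i\<in>{i \<in> L q. i < m}. max 0 (D m - \<gamma> i))
                = (\<Sum>i\<in>{i \<in> L q. i < m}. max 0 (utility (u m) c i j - utility (u m) c i (a i)))"
              by (intro sum.cong) (auto simp: L_def q D_def \<gamma>_def pair_def utility_def mT algebra_simps)
            also have "\<dots> \<le> f (m - 1)"
              using mT False by (intro consistent_values_sum_le) (auto simp: L_def M2_def)
            also have "\<dots> \<le> F"
              unfolding F_def using mT False T by (intro mono_onD[OF f_mono]) auto
            finally show ?thesis .
          qed
        qed (use fin bounds l delta_pos \<open>\<delta> \<le> 2\<close> F in \<open>auto simp: L_def\<close>)
        \<comment> \<open>The bounds \<open>1 - l \<le> x \<le> 1 / 2\<close> and
          \<open>ln z \<le> z\<close> at \<open>z = 2 / \<delta>\<close> turn the logarithmic term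
          into \<open>1 / \<delta>\<close>.\<close>
        also have "\<dots> \<le> (F + 1) / \<delta>"
        proof -
          have "1 - l \<le> 1 / 2" using exp_ge_add_one_self[of "- x"] x by (simp add: l_def)
          moreover have "0 \<le> ln (2 / \<delta>)" "ln (2 / \<delta>) \<le> 2 / \<delta>"
            using \<open>\<delta> \<le> 2\<close> delta_pos ln_bound[of "2 / \<delta>"] by auto
          ultimately have "(1 - l) * ln (2 / \<delta>) \<le> 1 / 2 * (2 / \<delta>)"
            by (intro mult_mono) auto
          then show ?thesis by (simp add: add_divide_distrib)
        qed
        finally show ?thesis
          using \<open>\<kappa> > 0\<close> delta_pos unfolding ln_l \<kappa>_def[symmetric] by (simp add: field_simps)
      qed
      \<comment> \<open>Witness arm and played arm always differ, so only \<open>k * (k - 1)\<close>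
        ordered pairs occur. The factor \<open>k - 1\<close> is then traded for \<open>ln T\<close>
        and \<open>\<kappa>\<close> cancels.\<close>
      define Q where "Q = (SIGMA j : (UNIV :: 'k set). UNIV - {j})"
      have "card Q = (\<Sum>j\<in>(UNIV :: 'k set). card (UNIV - {j}))" unfolding Q_def by (intro card_SigmaI) auto
      also have "\<dots> = k * (k - 1)" by (simp add: card_Diff_singleton k_def)
      finally have cQ: "real (card Q) = real k * (real k - 1)" using k by (simp add: of_nat_diff)
      have "M2 = (\<Union>q\<in>Q. L q)"
        using w by (force simp: L_def Q_def pair_def)
      then have "card M2 \<le> (\<Sum>q\<in>Q. card (L q))" by (metis card_UN_le finite)
      then have "real (card M2) \<le> (\<Sum>q\<in>Q. real (card (L q)))" by (metis of_nat_mono of_nat_sum)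
      also have "\<dots> \<le> (\<Sum>q\<in>Q. (F + 1) / (\<delta> * \<kappa>))" by (intro sum_mono L_le)
      also have "\<dots> = (real k - 1) * (real k * (F + 1) / (\<delta> * \<kappa>))" by (simp add: cQ)
      also have "\<dots> \<le> (\<kappa> * real k ^ 3 * ln T) * (real k * (F + 1) / (\<delta> * \<kappa>))"
        using factor F delta_pos \<open>\<kappa> > 0\<close> by (intro mult_right_mono) auto
      also have "\<dots> = real k ^ 4 * (F + 1) * ln T / \<delta>"
        using \<open>\<kappa> > 0\<close> delta_pos by (simp add: field_simps power3_eq_cube power4_eq_xxxx)
      finally show ?thesis .
    qed
  qed
  have "card {t \<in> {1..T}. p t \<noteq> a t} \<le> card (M1 \<union> M2)"
    using fin by (intro card_mono) (auto simp: M1_def M2_def)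
  also have "\<dots> \<le> card M1 + card M2" by (rule card_Un_le)
  finally have "real (card {t \<in> {1..T}. p t \<noteq> a t}) \<le> real (card M1) + real (card M2)"
    by linarith
  also have "\<dots> \<le> F / \<delta> + real k ^ 4 * (F + 1) * ln T / \<delta>" using M1 M2 by simp
  finally show ?thesis by (simp add: F_def k_def add_divide_distrib add.commute)
qed

end
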